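(* Let $1<p<2$. If a Banach space $X$ has property $p$-$(V^{*})$, then $X$ is weakly sequentially complete of order $p$.
   Context: Banach spaces are real or complex. For $1\le p<\infty$, a sequence $(z_n)_n$ in a Banach space $Z$ is weakly $p$-summable if $\sum_{n}|\langle z^{*},z_n\rangle|^{p}<\infty$ for every $z^{*}\in Z^{*}$. A bounded subset $K$ of a Banach space $X$ is a $p$-$(V^{*})$ set if $\lim_{n}\sup_{x\in K}|\langle x_n^{*},x\rangle|=0$ for every weakly $p$-summable sequence $(x_n^{*})_n$ in $X^{*}$. A Banach space $X$ has property $p$-$(V^{*})$ if every $p$-$(V^{*})$ subset of $X$ is relatively weakly compact. A sequence $(x_n)_n$ in $X$ is weakly $p$-convergent to $x\in X$ if $(x_n-x)_n$ is weakly $p$-summable; it is weakly $p$-convergent if it is weakly $p$-convergent to some $x\in X$. A sequence $(x_n)_n$ in $X$ is weakly $p$-Cauchy if for each pair of strictly increasing sequences $(k_n)_n$, $(j_n)_n$ of positive integers, the sequence $(x_{k_n}-x_{j_n})_n$ is weakly $p$-summable. $X$ is weakly sequentially complete of order $p$ if every weakly $p$-Cauchy sequence in $X$ is weakly $p$-convergent. *)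

theory Defs
  imports "HOL-Analysis.Analysis"
begin

(* A complex Banach space is a real one (class banach) together with a multiplication by complex
   scalars as below. To treat real and complex spaces at once, the definitions of this theory
   take the scalar multiplication as a parameter; for real spaces it is scaleR. *)

locale normed_scaling = vector_space smul
  for smul :: "'k::real_normed_field \<Rightarrow> 'a::real_normed_vector \<Rightarrow> 'a" +
  assumes smul_of_real: "smul (of_real r) x = r *\<^sub>R x"
    and norm_smul: "norm (smul c x) = norm c * norm x"

lemma normed_scaling_scaleR:
  "normed_scaling (scaleR :: real \<Rightarrow> 'a::real_normed_vector \<Rightarrow> 'a)"
  by unfold_locales (auto simp: algebra_simps)

(* Bounded scalar-linear functionals on a subspace S. Only their values on S matter. A subspace
   is allowed because the dual of a complex space is a proper subspace of the type of bounded
   real-linear maps into the complex numbers. *)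

definition functionals_on ::
    "('k::real_normed_field \<Rightarrow> 'a::real_normed_vector \<Rightarrow> 'a) \<Rightarrow> 'a set \<Rightarrow> ('a \<Rightarrow> 'k) set" where
  "functionals_on smul S = {\<phi>.
     (\<forall>x\<in>S. \<forall>y\<in>S. \<phi> (x + y) = \<phi> x + \<phi> y) \<and>
     (\<forall>c. \<forall>x\<in>S. \<phi> (smul c x) = c * \<phi> x) \<and>
     (\<exists>B. \<forall>x\<in>S. norm (\<phi> x) \<le> B * norm x)}"

definition dual ::
    "('k::real_normed_field \<Rightarrow> 'a::real_normed_vector \<Rightarrow> 'a) \<Rightarrow> ('a \<Rightarrow>\<^sub>L 'k) set" where
  "dual smul = {f. blinfun_apply f \<in> functionals_on smul UNIV}"

definition dual_scale ::
    "'k::real_normed_field \<Rightarrow> ('a::real_normed_vector \<Rightarrow>\<^sub>L 'k) \<Rightarrow> ('a \<Rightarrow>\<^sub>L 'k)" where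
  "dual_scale c f = blinfun_mult_right c o\<^sub>L f"

lemma blinfun_apply_dual_scale [simp]:
  "blinfun_apply (dual_scale c f) x = c * blinfun_apply f x"
  by (simp add: dual_scale_def)

lemma normed_scaling_dual_scale:
  "normed_scaling
     (dual_scale :: 'k::real_normed_field \<Rightarrow> ('a::real_normed_vector \<Rightarrow>\<^sub>L 'k) \<Rightarrow> ('a \<Rightarrow>\<^sub>L 'k))"
proof unfold_locales
  fix c :: 'k and f :: "'a \<Rightarrow>\<^sub>L 'k"
  have "onorm (\<lambda>x. c * blinfun_apply f x) = norm c * onorm (blinfun_apply f)"
  proof (cases "c = 0")
    case True
    then show ?thesis by (simp add: onorm_zero)
  next
    case False
    have bl: "bounded_linear (\<lambda>x. c * blinfun_apply f x)"
      by (intro bounded_linear_intros)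
    show ?thesis
    proof (rule antisym)
      show "onorm (\<lambda>x. c * blinfun_apply f x) \<le> norm c * onorm (blinfun_apply f)"
      proof (rule onorm_bound)
        show "0 \<le> norm c * onorm (blinfun_apply f)"
          by (simp add: onorm_pos_le blinfun.bounded_linear_right)
        fix x
        show "norm (c * blinfun_apply f x) \<le> norm c * onorm (blinfun_apply f) * norm x"
          by (simp add: norm_mult mult.assoc mult_left_mono onorm blinfun.bounded_linear_right)
      qed
      have "onorm (blinfun_apply f) \<le> onorm (\<lambda>x. c * blinfun_apply f x) / norm c"
      proof (rule onorm_bound)
        show "0 \<le> onorm (\<lambda>x. c * blinfun_apply f x) / norm c"
          by (simp add: onorm_pos_le[OF bl])
        fix x
        show "norm (blinfun_apply f x) \<le> onorm (\<lambda>x. c * blinfun_apply f x) / norm c * norm x"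
          using onorm[OF bl, of x] False by (simp add: norm_mult field_simps)
      qed
      then show "norm c * onorm (blinfun_apply f) \<le> onorm (\<lambda>x. c * blinfun_apply f x)"
        using False by (simp add: field_simps)
    qed
  qed
  moreover have "blinfun_apply (dual_scale c f) = (\<lambda>x. c * blinfun_apply f x)"
    by auto
  ultimately show "norm (dual_scale c f) = norm c * norm f"
    by (simp add: norm_blinfun.rep_eq)
qed (auto intro!: blinfun_eqI simp: blinfun.bilinear_simps algebra_simps scaleR_conv_of_real)

lemma dual_scaleR: "dual (scaleR :: real \<Rightarrow> 'a::real_normed_vector \<Rightarrow> 'a) = UNIV"
proof -
  have "\<exists>B. \<forall>x. \<bar>blinfun_apply f x\<bar> \<le> B * norm x" for f :: "'a \<Rightarrow>\<^sub>L real"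
    using norm_blinfun[of f] by (auto simp: real_norm_def)
  then show ?thesis
    by (auto simp: dual_def functionals_on_def blinfun.bilinear_simps)
qed

definition weakly_p_summable ::
    "real \<Rightarrow> ('k::real_normed_field \<Rightarrow> 'a::real_normed_vector \<Rightarrow> 'a) \<Rightarrow> 'a set \<Rightarrow> (nat \<Rightarrow> 'a) \<Rightarrow> bool"
  where
  "weakly_p_summable p smul S z \<longleftrightarrow>
     (\<forall>n. z n \<in> S) \<and> (\<forall>\<phi>\<in>functionals_on smul S. summable (\<lambda>n. norm (\<phi> (z n)) powr p))"

(* For empty K the real supremum below is unspecified; this is harmless for property_p_V_star,
   as the empty set is relatively weakly compact. *)

definition p_V_star_set ::
    "real \<Rightarrow> ('k::real_normed_field \<Rightarrow> 'a::real_normed_vector \<Rightarrow> 'a) \<Rightarrow> 'a set \<Rightarrow> bool" where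
  "p_V_star_set p smul K \<longleftrightarrow> bounded K \<and>
     (\<forall>f. weakly_p_summable p dual_scale (dual smul) f \<longrightarrow>
        (\<lambda>n. SUP x\<in>K. norm (blinfun_apply (f n) x)) \<longlonglongrightarrow> 0)"

definition weak_topology ::
    "('k::real_normed_field \<Rightarrow> 'a::real_normed_vector \<Rightarrow> 'a) \<Rightarrow> 'a topology" where
  "weak_topology smul =
     topology_generated_by {\<phi> -` U | \<phi> U. \<phi> \<in> functionals_on smul UNIV \<and> open U}"

definition relatively_weakly_compact ::
    "('k::real_normed_field \<Rightarrow> 'a::real_normed_vector \<Rightarrow> 'a) \<Rightarrow> 'a set \<Rightarrow> bool" where
  "relatively_weakly_compact smul K \<longleftrightarrow>
     compactin (weak_topology smul) (weak_topology smul closure_of K)"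

definition property_p_V_star ::
    "real \<Rightarrow> ('k::real_normed_field \<Rightarrow> 'a::real_normed_vector \<Rightarrow> 'a) \<Rightarrow> bool" where
  "property_p_V_star p smul \<longleftrightarrow>
     (\<forall>K. p_V_star_set p smul K \<longrightarrow> relatively_weakly_compact smul K)"

definition weakly_p_convergent_to ::
    "real \<Rightarrow> ('k::real_normed_field \<Rightarrow> 'a::real_normed_vector \<Rightarrow> 'a) \<Rightarrow> (nat \<Rightarrow> 'a) \<Rightarrow> 'a \<Rightarrow> bool" where
  "weakly_p_convergent_to p smul x l \<longleftrightarrow> weakly_p_summable p smul UNIV (\<lambda>n. x n - l)"

definition weakly_p_convergent ::
    "real \<Rightarrow> ('k::real_normed_field \<Rightarrow> 'a::real_normed_vector \<Rightarrow> 'a) \<Rightarrow> (nat \<Rightarrow> 'a) \<Rightarrow> bool" where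
  "weakly_p_convergent p smul x \<longleftrightarrow> (\<exists>l. weakly_p_convergent_to p smul x l)"

definition weakly_p_Cauchy ::
    "real \<Rightarrow> ('k::real_normed_field \<Rightarrow> 'a::real_normed_vector \<Rightarrow> 'a) \<Rightarrow> (nat \<Rightarrow> 'a) \<Rightarrow> bool" where
  "weakly_p_Cauchy p smul x \<longleftrightarrow>
     (\<forall>k j :: nat \<Rightarrow> nat. strict_mono k \<longrightarrow> strict_mono j \<longrightarrow>
        weakly_p_summable p smul UNIV (\<lambda>n. x (k n) - x (j n)))"

definition weakly_seq_complete_of_order ::
    "real \<Rightarrow> ('k::real_normed_field \<Rightarrow> 'a::real_normed_vector \<Rightarrow> 'a) \<Rightarrow> bool" where
  "weakly_seq_complete_of_order p smul \<longleftrightarrow>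
     (\<forall>x. weakly_p_Cauchy p smul x \<longrightarrow> weakly_p_convergent p smul x)"

end

theory Submission
  imports Defs
begin

text \<open>
  Let \<open>x\<close> be weakly \<open>p\<close>-Cauchy. Along every functional \<open>\<phi>\<close> the scalars \<open>\<phi> (x n)\<close> form a Cauchy sequence, so
  \<open>x\<close> is bounded. The heart of the matter is that the range of \<open>x\<close> is a \<open>p\<close>-\<open>(V\<^sup>*)\<close> set. If it were
  not, a gliding hump argument would yield a weakly \<open>p\<close>-summable sequence of functionals \<open>f n\<close> and a weakly
  \<open>p\<close>-summable sequence of differences \<open>y n = x (k n) - x (j n)\<close> such that \<open>f n (y n)\<close> stays away from 0.
  
  For \<open>p < 2\<close> this cannot happen. The sequence \<open>f\<close> is a bounded operator into \<open>\<ell>\<^sup>p\<close>, and \<open>y\<close> is one from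
  \<open>\<ell>\<^sup>q\<close> for the conjugate exponent \<open>q\<close>, so the matrix \<open>f i (y j)\<close> is an operator from \<open>\<ell>\<^sup>q\<close> to \<open>\<ell>\<^sup>p\<close>.
  Averaging over signs shows that its diagonal is one, too. On the sum of the first \<open>N\<close> unit vectors,
  whose norm in \<open>\<ell>\<^sup>q\<close> is \<open>N powr (1 / q)\<close>, a diagonal with entries bounded away from 0 takes a value of
  norm at least a multiple of \<open>N powr (1 / p)\<close>. As \<open>1 / q < 1 / p\<close>, this is impossible for
  large \<open>N\<close>. The lemmas \<open>diagonal_p_sum_bound\<close> and \<open>weakly_p_summable_pairing_small\<close> carry out this argument
  with finite sums only.
  
  Property \<open>p\<close>-\<open>(V\<^sup>*)\<close> now makes the range of \<open>x\<close> relatively weakly compact, so \<open>x\<close> has a weak cluster point \<open>l\<close>,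
  and \<open>\<phi> (x n)\<close> converges to \<open>\<phi> l\<close> for every \<open>\<phi>\<close>. For fixed \<open>\<phi>\<close>, comparing \<open>\<phi> (x n)\<close> with a subsequence that
  converges very fast turns summability of differences into summability of the \<open>p\<close>-th powers of
  \<open>\<phi> (x n - l)\<close>.
  
  Two classical tools are derived on the way: norming functionals, by a minimal sublinear functional, and
  uniform boundedness, by Baire's theorem.
\<close>

section \<open>Norming functionals\<close>

text \<open>
  Only the two inequalities are required; \<open>q 0 = 0\<close> and equality in the homogeneity condition follow.
  A weak condition is convenient, since sublinearity is verified below for infima.
\<close>

definition sublinear :: "('a::real_vector \<Rightarrow> real) \<Rightarrow> bool" where
  "sublinear q \<longleftrightarrow> (\<forall>x y. q (x + y) \<le> q x + q y) \<and> (\<forall>t x. 0 < t \<longrightarrow> q (t *\<^sub>R x) \<le> t * q x)"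

lemma sublinear_add: "sublinear q \<Longrightarrow> q (x + y) \<le> q x + q y"
  and sublinear_scale_le: "sublinear q \<Longrightarrow> 0 < t \<Longrightarrow> q (t *\<^sub>R x) \<le> t * q x"
  by (auto simp: sublinear_def)

lemma sublinear_zero:
  assumes "sublinear q" shows "q 0 = 0"
  using sublinear_scale_le[OF assms, of 2 0] sublinear_scale_le[OF assms, of "1/2" 0] by auto

lemma sublinear_scale:
  assumes "sublinear q" "0 \<le> t" shows "q (t *\<^sub>R x) = t * q x"
proof (cases "t = 0")
  case True
  then show ?thesis by (simp add: sublinear_zero[OF assms(1)])
next
  case False
  with assms have t: "0 < t" by simp
  have "q x \<le> inverse t * q (t *\<^sub>R x)"
    using sublinear_scale_le[OF assms(1), of "inverse t" "t *\<^sub>R x"] t by simp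
  then show ?thesis
    using sublinear_scale_le[OF assms(1) t, of x] t by (auto simp: field_simps)
qed

lemma sublinear_minus:
  assumes "sublinear q" shows "- q (- x) \<le> q x"
  using sublinear_add[OF assms, of x "- x"] sublinear_zero[OF assms] by simp

text \<open>
  The largest sublinear functional \<open>r \<le> q\<close> with \<open>r (- y) \<le> - q y\<close>. It serves twice: tilting the norm along
  a given vector forces functionals below it to attain the norm there, and a \<open>q\<close> that tilting cannot
  lower is additive.
\<close>

definition tilt :: "('a::real_vector \<Rightarrow> real) \<Rightarrow> 'a \<Rightarrow> 'a \<Rightarrow> real" where
  "tilt q y x = (INF t\<in>{0..}. q (x + t *\<^sub>R y) - t * q y)"

lemma tilt_bdd_below:
  assumes "sublinear q"
  shows "bdd_below ((\<lambda>t. q (x + t *\<^sub>R y) - t * q y) ` {0..})"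
proof (rule bdd_belowI2)
  fix t :: real assume "t \<in> {0..}"
  then have "t * q y = q (t *\<^sub>R y)" by (simp add: sublinear_scale[OF assms])
  also have "\<dots> \<le> q (x + t *\<^sub>R y) + q (- x)"
    using sublinear_add[OF assms, of "x + t *\<^sub>R y" "- x"] by simp
  finally show "- q (- x) \<le> q (x + t *\<^sub>R y) - t * q y" by simp
qed

lemma tilt_le:
  assumes "sublinear q" "0 \<le> t"
  shows "tilt q y x \<le> q (x + t *\<^sub>R y) - t * q y"
  unfolding tilt_def using assms by (intro cINF_lower tilt_bdd_below) auto

lemma le_tilt:
  assumes "\<And>t. 0 \<le> t \<Longrightarrow> c \<le> q (x + t *\<^sub>R y) - t * q y"
  shows "c \<le> tilt q y x"
  unfolding tilt_def using assms by (intro cINF_greatest) auto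

lemma sublinear_tilt:
  assumes "sublinear q" shows "sublinear (tilt q y)"
  unfolding sublinear_def
proof (intro conjI allI impI)
  fix a b
  have "tilt q y (a + b) - (q (b + t *\<^sub>R y) - t * q y) \<le> tilt q y a" if t: "0 \<le> t" for t
  proof (rule le_tilt)
    fix s :: real assume s: "0 \<le> s"
    have "tilt q y (a + b) \<le> q (a + b + (s + t) *\<^sub>R y) - (s + t) * q y"
      using s t by (intro tilt_le assms) simp
    also have "q (a + b + (s + t) *\<^sub>R y) \<le> q (a + s *\<^sub>R y) + q (b + t *\<^sub>R y)"
      using sublinear_add[OF assms, of "a + s *\<^sub>R y" "b + t *\<^sub>R y"] by (simp add: algebra_simps)
    finally show "tilt q y (a + b) - (q (b + t *\<^sub>R y) - t * q y) \<le> q (a + s *\<^sub>R y) - s * q y"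
      by (simp add: algebra_simps)
  qed
  then have "tilt q y (a + b) - tilt q y a \<le> tilt q y b"
    by (intro le_tilt) (smt (verit))
  then show "tilt q y (a + b) \<le> tilt q y a + tilt q y b" by simp
next
  fix s :: real and a assume s: "0 < s"
  have "tilt q y (s *\<^sub>R a) / s \<le> tilt q y a"
  proof (rule le_tilt)
    fix t :: real assume t: "0 \<le> t"
    have "tilt q y (s *\<^sub>R a) \<le> q (s *\<^sub>R a + (s * t) *\<^sub>R y) - (s * t) * q y"
      using s t by (intro tilt_le assms) simp
    also have "q (s *\<^sub>R a + (s * t) *\<^sub>R y) = s * q (a + t *\<^sub>R y)"
      using sublinear_scale[OF assms, of s "a + t *\<^sub>R y"] s by (simp add: algebra_simps)
    finally show "tilt q y (s *\<^sub>R a) / s \<le> q (a + t *\<^sub>R y) - t * q y"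
      using s by (simp add: field_simps)
  qed
  then show "tilt q y (s *\<^sub>R a) \<le> s * tilt q y a" using s by (simp add: field_simps)
qed

text \<open>
  The Hahn-Banach theorem, in the form that avoids extending functionals from subspaces: by Zorn's lemma
  there is a minimal sublinear functional \<open>m\<close> below \<open>q\<close>. Tilting cannot lower \<open>m\<close>, that is,
  \<open>m x \<le> m (x + y) - m y\<close>, so \<open>m\<close> is additive and therefore linear.
\<close>

lemma linear_below_sublinear:
  assumes q: "sublinear q"
  obtains f where "linear f" "\<And>x. f x \<le> q x"
proof -
  define S where "S = {r. sublinear r \<and> (\<forall>x. r x \<le> q x)}"
  define P :: "('a \<Rightarrow> real) \<Rightarrow> ('a \<Rightarrow> real) \<Rightarrow> bool" where "P r s \<longleftrightarrow> (\<forall>x. s x \<le> r x)" for r s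
  have "\<exists>m\<in>S. \<forall>r\<in>S. P m r \<longrightarrow> r = m"
  proof (rule predicate_Zorn)
    show "partial_order_on S (relation_of P S)"
      by (rule partial_order_on_relation_ofI) (auto simp: P_def fun_eq_iff intro: order_trans antisym)
    fix C assume C: "C \<in> Chains (relation_of P S)"
    then have CS: "r \<in> S" if "r \<in> C" for r
      using that Chains_relation_of by blast
    have tot: "P r s \<or> P s r" if "r \<in> C" "s \<in> C" for r s
      using C that unfolding Chains_def relation_of_def by auto
    show "\<exists>u\<in>S. \<forall>r\<in>C. P r u"
    proof (cases "C = {}")
      case True
      then show ?thesis using q by (auto simp: S_def)
    next
      case False
      define u where "u x = (INF r\<in>C. r x)" for x
      have "bdd_below ((\<lambda>r. r x) ` C)" for x
      proof (rule bdd_belowI2)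
        fix r assume "r \<in> C"
        then have "sublinear r" "r (- x) \<le> q (- x)" using CS by (auto simp: S_def)
        then show "- q (- x) \<le> r x" using sublinear_minus[of r x] by linarith
      qed
      then have u_le: "u x \<le> r x" if "r \<in> C" for r x
        unfolding u_def using that by (rule cINF_lower)
      have le_u: "c \<le> u x" if "\<And>r. r \<in> C \<Longrightarrow> c \<le> r x" for c x
        unfolding u_def using False that by (rule cINF_greatest)
      have "sublinear u"
        unfolding sublinear_def
      proof (intro conjI allI impI)
        fix a b
        \<comment> \<open>Of two members of the chain the smaller one serves for both arguments.\<close>
        have *: "u (a + b) \<le> r a + s b" if rs: "r \<in> C" "s \<in> C" for r s
        proof -
          obtain w where w: "w \<in> C" "w a \<le> r a" "w b \<le> s b"
            using tot[OF rs] rs unfolding P_def by blast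
          then have "u (a + b) \<le> w (a + b)" by (intro u_le)
          also have "\<dots> \<le> w a + w b" using CS[OF w(1)] by (simp add: S_def sublinear_add)
          finally show ?thesis using w by linarith
        qed
        have "u (a + b) - s b \<le> u a" if "s \<in> C" for s
          using *[OF _ that] by (intro le_u) (simp add: algebra_simps)
        then have "u (a + b) - u a \<le> u b" by (intro le_u) (smt (verit))
        then show "u (a + b) \<le> u a + u b" by simp
      next
        fix t :: real and a assume t: "0 < t"
        have "u (t *\<^sub>R a) / t \<le> u a"
        proof (rule le_u)
          fix r assume r: "r \<in> C"
          then have "u (t *\<^sub>R a) \<le> r (t *\<^sub>R a)" by (rule u_le)
          also have "\<dots> \<le> t * r a" using CS[OF r] t by (simp add: S_def sublinear_scale_le)
          finally show "u (t *\<^sub>R a) / t \<le> r a" using t by (simp add: field_simps)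
        qed
        then show "u (t *\<^sub>R a) \<le> t * u a" using t by (simp add: field_simps)
      qed
      moreover obtain r0 where "r0 \<in> C" using False by blast
      then have "u x \<le> q x" for x
        using u_le[of r0 x] CS[of r0] by (auto simp: S_def intro: order_trans)
      ultimately have "u \<in> S" by (simp add: S_def)
      then show ?thesis using u_le by (auto simp: P_def)
    qed
  qed
  then obtain m where mS: "m \<in> S" and min: "\<And>r. r \<in> S \<Longrightarrow> (\<And>x. r x \<le> m x) \<Longrightarrow> r = m"
    by (auto simp: P_def)
  have m: "sublinear m" and mq: "m x \<le> q x" for x using mS by (auto simp: S_def)
  have add: "m (x + y) = m x + m y" for x y
  proof -
    have le: "tilt m y z \<le> m z" for z using tilt_le[OF m, of 0 y z] by simp
    have "tilt m y = m"
      by (rule min) (use le mq sublinear_tilt[OF m] in \<open>auto simp: S_def intro: order_trans\<close>)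
    then have "m x \<le> m (x + y) - m y" using tilt_le[OF m, of 1 y x] by simp
    then show ?thesis using sublinear_add[OF m, of x y] by linarith
  qed
  have neg: "m (- x) = - m x" for x using add[of x "- x"] sublinear_zero[OF m] by simp
  have "linear m"
  proof (rule linearI)
    fix t :: real and x
    show "m (t *\<^sub>R x) = t *\<^sub>R m x"
      using sublinear_scale[OF m, of t x] sublinear_scale[OF m, of "- t" x] neg[of "t *\<^sub>R x"]
      by (cases "0 \<le> t") auto
  qed (rule add)
  then show thesis using mq that by blast
qed

text \<open>
  A linear functional below the norm tilted along \<open>a\<close> is at most \<open>- norm a\<close> at \<open>- a\<close>.
\<close>

lemma norming_real_functional:
  fixes a :: "'a::real_normed_vector"
  obtains f :: "'a \<Rightarrow> real" where "linear f" "\<And>x. \<bar>f x\<bar> \<le> norm x" "f a = norm a"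
proof -
  have n: "sublinear (norm :: 'a \<Rightarrow> real)" by (auto simp: sublinear_def norm_triangle_ineq)
  obtain f where f: "linear f" "\<And>x. f x \<le> tilt norm a x"
    using linear_below_sublinear[OF sublinear_tilt[OF n]] by blast
  have le: "f x \<le> norm x" for x
    using f(2)[of x] tilt_le[OF n, of 0 a x] by simp
  have neg: "f (- x) = - f x" for x using f(1) by (rule linear_neg)
  have "f (- a) \<le> - norm a" using f(2)[of "- a"] tilt_le[OF n, of 1 a "- a"] by simp
  then have "f a = norm a" using le[of a] neg[of a] by simp
  moreover have "\<bar>f x\<bar> \<le> norm x" for x using le[of x] le[of "- x"] neg[of x] by simp
  ultimately show thesis using f(1) that by blast
qed

section \<open>Uniform boundedness\<close>

text \<open>
  The principle of uniform boundedness, by Baire's theorem in \<open>D\<close>: some set \<open>{a \<in> D. \<forall>n. h n a \<le> m}\<close> contains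
  a ball around some \<open>a0\<close>, and every small \<open>a\<close> is half the difference of \<open>a0 + a\<close> and \<open>a0 - a\<close>. The
  midpoint condition covers norms of linear maps as well as \<open>p\<close>-th power sums of such norms. A closed
  subspace is allowed because the dual of a complex space is one in the space of bounded real-linear maps.
\<close>

lemma uniform_boundedness_on_closed_subspace:
  fixes h :: "nat \<Rightarrow> 'a::banach \<Rightarrow> real"
  assumes D: "closed D" "subspace D"
    and cont: "\<And>n. continuous_on UNIV (h n)"
    and mid: "\<And>n a b. h n ((1/2) *\<^sub>R (a - b)) \<le> max (h n a) (h n b)"
    and bdd: "\<And>a. a \<in> D \<Longrightarrow> \<exists>M. \<forall>n. h n a \<le> M"
  obtains r M where "0 < r" "\<And>n a. a \<in> D \<Longrightarrow> norm a \<le> r \<Longrightarrow> h n a \<le> M"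
proof -
  define F where "F m = {a\<in>D. \<forall>n. h n a \<le> real m}" for m :: nat
  have clos: "closedin (top_of_set D) (F m)" for m
  proof -
    have "closed (\<Inter>n. {a. h n a \<le> real m})"
      by (intro closed_INT ballI closed_Collect_le cont continuous_on_const)
    moreover have "F m = D \<inter> (\<Inter>n. {a. h n a \<le> real m})" by (auto simp: F_def)
    ultimately show ?thesis by (auto simp: closedin_closed)
  qed
  have "D \<subseteq> (\<Union>m. F m)"
  proof
    fix a assume a: "a \<in> D"
    then obtain M where M: "\<And>n. h n a \<le> M" using bdd by blast
    obtain m where "M \<le> real m" using real_arch_simple by blast
    then have "a \<in> F m" using a M by (auto simp: F_def intro: order_trans)
    then show "a \<in> (\<Union>m. F m)" by blast
  qed
  then have "(\<Union>m. F m) = D" by (auto simp: F_def)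
  then have "top_of_set D interior_of \<Union>(range F) = D"
    by (metis interior_of_topspace topspace_euclidean_subtopology)
  then have "top_of_set D interior_of \<Union>(range F) \<noteq> {}"
    using subspace_0[OF D(2)] by auto
  moreover have "completely_metrizable_space (top_of_set D)"
    using D(1) by (intro completely_metrizable_space_closedin completely_metrizable_space_euclidean)
      auto
  ultimately obtain m where "top_of_set D interior_of F m \<noteq> {}"
    using Baire_category_alt[of "top_of_set D" "range F"] clos by auto
  then obtain U a0 where U: "openin (top_of_set D) U" "a0 \<in> U" "U \<subseteq> F m"
    unfolding interior_of_def by auto
  then obtain e where e: "0 < e" "ball a0 e \<inter> D \<subseteq> U"
    by (meson openin_contains_ball)
  have a0: "a0 \<in> D" using U by (auto simp: F_def)
  show thesis
  proof
    show "0 < e / 2" using e by simp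
    fix n a assume a: "a \<in> D" "norm a \<le> e / 2"
    have "a0 + a \<in> ball a0 e \<inter> D" "a0 - a \<in> ball a0 e \<inter> D"
      using a a0 D(2) e(1) by (auto simp: dist_norm subspace_add subspace_diff)
    then have "a0 + a \<in> F m" "a0 - a \<in> F m" using e(2) U(3) by blast+
    then have "max (h n (a0 + a)) (h n (a0 - a)) \<le> real m" by (simp add: F_def)
    moreover have "a = (1/2) *\<^sub>R ((a0 + a) - (a0 - a))"
      by (simp add: scaleR_2[symmetric])
    ultimately show "h n a \<le> real m" using mid[of n "a0 + a" "a0 - a"] by (metis order_trans)
  qed
qed

text \<open>
  Norms may vanish, so convexity of the power function is needed with the endpoint 0 included.
\<close>

lemma convex_on_powr:
  assumes "1 \<le> p" shows "convex_on {0..} (\<lambda>x::real. x powr p)"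
proof (rule convex_onI)
  fix t x y :: real
  assume t: "0 < t" "t < 1" and xy: "x \<in> {0..}" "y \<in> {0..}"
  have shrink: "(s * z) powr p \<le> s * z powr p" if "0 < s" "s < 1" "0 \<le> z" for s z :: real
  proof -
    have "s powr p \<le> s" using powr_mono'[OF assms, of s] that by simp
    then show ?thesis using that by (simp add: powr_mult mult_right_mono)
  qed
  show "((1 - t) *\<^sub>R x + t *\<^sub>R y) powr p \<le> (1 - t) * x powr p + t * y powr p"
  proof (cases "x = 0 \<or> y = 0")
    case True
    then show ?thesis using shrink[of t y] shrink[of "1 - t" x] t xy assms by auto
  next
    case False
    then show ?thesis
      using convex_onD[OF powr_convex[OF assms], of t x y] t xy by simp
  qed
qed simp

lemma norm_powr_midpoint:
  fixes a b :: "'a::real_normed_vector"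
  assumes "1 \<le> p"
  shows "norm ((1/2) *\<^sub>R (a - b)) powr p \<le> (norm a powr p + norm b powr p) / 2"
proof -
  have "norm ((1/2) *\<^sub>R (a - b)) powr p \<le> (1/2 * norm a + 1/2 * norm b) powr p"
    using assms norm_triangle_ineq4[of a b] by (intro powr_mono2) auto
  also have "\<dots> \<le> 1/2 * norm a powr p + 1/2 * norm b powr p"
    using convex_onD[OF convex_on_powr[OF assms], of "1/2" "norm a" "norm b"] by simp
  finally show ?thesis by simp
qed

text \<open>
  Hoelder's inequality against the constant sequence 1, obtained from Jensen's inequality.
\<close>

lemma powr_sum_le:
  fixes a :: "nat \<Rightarrow> real"
  assumes p: "1 \<le> p" and a: "\<And>i. 0 \<le> a i"
  shows "(\<Sum>i<N. a i) powr p \<le> real N powr (p - 1) * (\<Sum>i<N. a i powr p)"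
proof (cases "N = 0")
  case False
  then have N: "0 < real N" by simp
  have "(\<Sum>i<N. (1 / real N) *\<^sub>R a i) powr p \<le> (\<Sum>i<N. (1 / real N) * a i powr p)"
    by (rule convex_on_sum[OF _ _ convex_on_powr[OF p], where S = "{..<N}"]) (use False a in auto)
  then have "((\<Sum>i<N. a i) / real N) powr p \<le> (\<Sum>i<N. a i powr p) / real N"
    by (simp add: sum_divide_distrib)
  then have "(\<Sum>i<N. a i) powr p / real N powr p \<le> (\<Sum>i<N. a i powr p) / real N"
    using a N by (simp add: powr_divide sum_nonneg)
  then show ?thesis using N by (simp add: field_simps powr_diff)
qed auto

text \<open>
  Finiteness of all the sums says that \<open>a \<mapsto> (g n a)\<^sub>n\<close> maps \<open>D\<close> into \<open>\<ell>\<^sup>p\<close>; the conclusion is that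
  this map is bounded. It is uniform boundedness for the partial sums, followed by rescaling.
\<close>

lemma uniform_p_summability:
  fixes g :: "nat \<Rightarrow> 'a::banach \<Rightarrow> 'k::real_normed_vector"
  assumes p: "1 \<le> p" and D: "closed D" "subspace D" and g: "\<And>n. bounded_linear (g n)"
    and sm: "\<And>a. a \<in> D \<Longrightarrow> summable (\<lambda>n. norm (g n a) powr p)"
  obtains C where "0 \<le> C" "\<And>N a. a \<in> D \<Longrightarrow> (\<Sum>i<N. norm (g i a) powr p) \<le> C * norm a powr p"
proof -
  define h where "h N a = (\<Sum>i<N. norm (g i a) powr p)" for N a
  have cont: "continuous_on UNIV (h N)" for N
    unfolding h_def using p
    by (intro continuous_intros continuous_on_powr' linear_continuous_on g) auto
  have mid: "h N ((1/2) *\<^sub>R (a - b)) \<le> max (h N a) (h N b)" for N a b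
  proof -
    have "h N ((1/2) *\<^sub>R (a - b)) \<le> (\<Sum>i<N. (norm (g i a) powr p + norm (g i b) powr p) / 2)"
      unfolding h_def
    proof (rule sum_mono)
      fix i
      interpret bounded_linear "g i" by (rule g)
      show "norm (g i ((1/2) *\<^sub>R (a - b))) powr p \<le> (norm (g i a) powr p + norm (g i b) powr p) / 2"
        using norm_powr_midpoint[OF p, of "g i a" "g i b"] by (simp only: scaleR diff)
    qed
    also have "\<dots> = (h N a + h N b) / 2"
      by (simp add: h_def sum.distrib flip: sum_divide_distrib)
    also have "\<dots> \<le> max (h N a) (h N b)" by (simp add: max_def field_simps)
    finally show ?thesis .
  qed
  have bdd: "\<exists>M. \<forall>N. h N a \<le> M" if "a \<in> D" for a
    using sum_le_suminf[OF sm[OF that]] by (auto simp: h_def)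
  obtain r M where r: "0 < r" and M: "\<And>N a. a \<in> D \<Longrightarrow> norm a \<le> r \<Longrightarrow> h N a \<le> M"
    using uniform_boundedness_on_closed_subspace[where h = h, OF D cont mid bdd] by blast
  have M0: "0 \<le> M" using M[of 0 0] subspace_0[OF D(2)] r by (simp add: h_def)
  show thesis
  proof
    show "0 \<le> M / r powr p" using M0 by simp
    fix N a assume a: "a \<in> D"
    show "(\<Sum>i<N. norm (g i a) powr p) \<le> M / r powr p * norm a powr p"
    proof (cases "a = 0")
      case True
      then show ?thesis using g M0 by (simp add: linear_0 bounded_linear.linear)
    next
      case False
      have "h N ((r / norm a) *\<^sub>R a) \<le> M"
        using a r False D(2) by (intro M) (auto simp: subspace_scale)
      also have "h N ((r / norm a) *\<^sub>R a) = (r / norm a) powr p * h N a"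
        using r False by (simp add: h_def sum_distrib_left linear_scale[OF bounded_linear.linear[OF g]]
            flip: powr_mult)
      finally show ?thesis using r False by (simp add: h_def powr_divide field_simps)
    qed
  qed
qed

section \<open>Scalar sequences with p-summable differences\<close>

text \<open>
  A sequence that is not Cauchy has two subsequences whose differences stay away from 0.
\<close>

lemma Cauchy_if_differences_p_summable:
  fixes a :: "nat \<Rightarrow> 'k::real_normed_vector"
  assumes p: "0 < p"
    and a: "\<And>k j :: nat \<Rightarrow> nat. strict_mono k \<Longrightarrow> strict_mono j \<Longrightarrow>
      summable (\<lambda>n. norm (a (k n) - a (j n)) powr p)"
  shows "Cauchy a"
proof (rule ccontr)
  assume "\<not> Cauchy a"
  then obtain e where e: "0 < e" and far: "\<And>M. \<exists>m\<ge>M. \<exists>n\<ge>M. e \<le> norm (a m - a n)"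
    unfolding Cauchy_def dist_norm by (meson not_less)
  have "\<exists>kj. \<forall>n. e \<le> norm (a (fst (kj n)) - a (snd (kj n))) \<and>
      fst (kj n) < fst (kj (Suc n)) \<and> snd (kj n) < snd (kj (Suc n))"
    (is "\<exists>kj. \<forall>n. ?P (kj n) \<and> ?R (kj n) (kj (Suc n))")
  proof (rule dependent_nat_choice[where P = "\<lambda>_. ?P" and Q = "\<lambda>_ u v. ?R u v", simplified])
    show "\<exists>m n. e \<le> norm (a m - a n)" using far by blast
    fix m n
    show "\<exists>m' n'. e \<le> norm (a m' - a n') \<and> m < m' \<and> n < n'"
      using far[of "Suc (max m n)"] by (meson Suc_le_lessD max.cobounded1 max.cobounded2 le_less_trans)
  qed
  then obtain kj where kj: "\<And>n. ?P (kj n)"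
    and "\<And>n. fst (kj n) < fst (kj (Suc n))" "\<And>n. snd (kj n) < snd (kj (Suc n))" by blast
  then have "strict_mono (\<lambda>n. fst (kj n))" "strict_mono (\<lambda>n. snd (kj n))"
    by (simp_all add: strict_mono_Suc_iff)
  then have "(\<lambda>n. norm (a (fst (kj n)) - a (snd (kj n))) powr p) \<longlonglongrightarrow> 0"
    by (intro summable_LIMSEQ_zero a)
  then have "\<forall>\<^sub>F n in sequentially. norm (a (fst (kj n)) - a (snd (kj n))) powr p < e powr p"
    using e by (intro order_tendstoD) auto
  then obtain n where "norm (a (fst (kj n)) - a (snd (kj n))) powr p < e powr p"
    by (auto simp: eventually_sequentially)
  moreover have "e powr p \<le> norm (a (fst (kj n)) - a (snd (kj n))) powr p"
    using kj e p by (intro powr_mono2) auto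
  ultimately show False by simp
qed

text \<open>
  Compare \<open>a\<close> with one subsequence that converges to \<open>l\<close> geometrically fast. The subsequence depends on \<open>a\<close>;
  the lemma can therefore be applied to one functional at a time only, which is enough.
\<close>

lemma p_summable_distance_to_limit:
  fixes a :: "nat \<Rightarrow> 'k::real_normed_vector"
  assumes p: "1 \<le> p" and lim: "a \<longlonglongrightarrow> l"
    and a: "\<And>j :: nat \<Rightarrow> nat. strict_mono j \<Longrightarrow> summable (\<lambda>n. norm (a n - a (j n)) powr p)"
  shows "summable (\<lambda>n. norm (a n - l) powr p)"
proof -
  have near: "\<exists>N. \<forall>m\<ge>N. norm (a m - l) < (1/2) ^ n" for n
    using LIMSEQ_D[OF lim, of "(1/2) ^ n"] by simp
  have "\<exists>j :: nat \<Rightarrow> nat. \<forall>n. norm (a (j n) - l) < (1/2) ^ n \<and> j n < j (Suc n)"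
  proof (rule dependent_nat_choice[where P = "\<lambda>n m. norm (a m - l) < (1/2) ^ n"
        and Q = "\<lambda>_ m m'. m < m'"])
    show "\<exists>m. norm (a m - l) < (1/2) ^ 0" using near[of 0] by blast
    fix m n :: nat
    obtain N where N: "\<And>m. N \<le> m \<Longrightarrow> norm (a m - l) < (1/2) ^ Suc n"
      using near[of "Suc n"] by blast
    show "\<exists>m'. norm (a m' - l) < (1/2) ^ Suc n \<and> m < m'"
      using N[of "max N (Suc m)"] by (intro exI[of _ "max N (Suc m)"]) auto
  qed
  then obtain j :: "nat \<Rightarrow> nat" where j: "\<And>n. norm (a (j n) - l) < (1/2) ^ n"
    and "\<And>n. j n < j (Suc n)" by blast
  then have "summable (\<lambda>n. norm (a n - a (j n)) powr p)"
    by (intro a) (simp add: strict_mono_Suc_iff)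
  moreover have "summable (\<lambda>n. norm (l - a (j n)) powr p)"
  proof (rule summable_comparison_test')
    show "summable (\<lambda>n. (1/2 :: real) ^ n)" by (simp add: summable_geometric)
    fix n
    have "norm (l - a (j n)) powr p \<le> ((1/2) ^ n) powr p"
      using j[of n] p by (intro powr_mono2) (auto simp: norm_minus_commute)
    also have "\<dots> \<le> (1/2) ^ n"
      using powr_mono'[OF p, of "(1/2) ^ n"] by (simp add: power_le_one)
    finally show "norm (norm (l - a (j n)) powr p) \<le> (1/2) ^ n" by simp
  qed
  ultimately have "summable (\<lambda>n. 2 powr p *
      ((norm (a n - a (j n)) powr p + norm (l - a (j n)) powr p) / 2))"
    by (intro summable_mult summable_divide summable_add)
  then show ?thesis
  proof (rule summable_comparison_test[rotated], intro exI[of _ 0] allI impI)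
    fix n
    have "norm (a n - l) powr p = (2 * norm ((1/2) *\<^sub>R ((a n - a (j n)) - (l - a (j n))))) powr p"
      by simp
    also have "\<dots> = 2 powr p * norm ((1/2) *\<^sub>R ((a n - a (j n)) - (l - a (j n)))) powr p"
      by (subst powr_mult) auto
    also have "\<dots> \<le> 2 powr p * ((norm (a n - a (j n)) powr p + norm (l - a (j n)) powr p) / 2)"
      by (intro mult_left_mono norm_powr_midpoint p) auto
    finally show "norm (norm (a n - l) powr p) \<le>
        2 powr p * ((norm (a n - a (j n)) powr p + norm (l - a (j n)) powr p) / 2)" by simp
  qed
qed

section \<open>Pairing weakly p-summable sequences\<close>

lemma summable_subsequence:
  fixes a :: "nat \<Rightarrow> real"
  assumes "summable a" "\<And>n. 0 \<le> a n" "strict_mono k"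
  shows "summable (\<lambda>n. a (k n))"
  using summable_reindex[of a k] assms by (simp add: o_def strict_mono_imp_inj_on)

lemma weakly_p_summable_subsequence:
  "weakly_p_summable p smul S z \<Longrightarrow> strict_mono k \<Longrightarrow> weakly_p_summable p smul S (\<lambda>n. z (k n))"
  unfolding weakly_p_summable_def
  using summable_subsequence[where k = k and a = "\<lambda>n. norm (_ (z n)) powr p"] by auto

definition sign_sum :: "(nat \<Rightarrow> 'a::real_vector) \<Rightarrow> nat \<Rightarrow> nat set \<Rightarrow> 'a" where
  "sign_sum v N A = (\<Sum>i<N. (if i \<in> A then 1 else -1) *\<^sub>R v i)"

text \<open>
  Flipping the \<open>j\<close>-th sign pairs off the sign choices. Two paired sums differ by \<open>\<plusminus> 2 v j\<close>, so by convexity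
  the mean of their \<open>p\<close>-th powers is at least that of \<open>v j\<close>. Summing over all pairs replaces an average
  over independent random signs.
\<close>

lemma norm_powr_le_average_sign_sum:
  fixes v :: "nat \<Rightarrow> 'a::real_normed_vector"
  assumes p: "1 \<le> p" and j: "j < N"
  shows "2 ^ N * norm (v j) powr p \<le> (\<Sum>A\<in>Pow {..<N}. norm (sign_sum v N A) powr p)"
proof -
  define flip where "flip A = (if j \<in> A then A - {j} else insert j A)" for A :: "nat set"
  have "flip (flip A) = A" for A by (cases "j \<in> A") (auto simp: flip_def)
  moreover have "flip A \<in> Pow {..<N}" if "A \<in> Pow {..<N}" for A
    using that j by (cases "j \<in> A") (auto simp: flip_def)
  ultimately have flip: "bij_betw flip (Pow {..<N}) (Pow {..<N})"
    by (intro bij_betwI[where g = flip]) auto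
  define F where "F A = norm (sign_sum v N A) powr p" for A
  have pair: "2 * norm (v j) powr p \<le> F A + F (flip A)" for A
  proof -
    define e :: real where "e = (if j \<in> A then 1 else -1)"
    have "sign_sum v N A - sign_sum v N (flip A) =
        (\<Sum>i<N. ((if i \<in> A then 1 else -1) - (if i \<in> flip A then 1 else -1)) *\<^sub>R v i)"
      by (simp only: sign_sum_def scaleR_diff_left flip: sum_subtractf)
    also have "\<dots> = (\<Sum>i<N. if i = j then (2 * e) *\<^sub>R v j else 0)"
    proof (rule sum.cong[OF refl])
      fix i
      show "((if i \<in> A then 1 else -1) - (if i \<in> flip A then 1 else -1)) *\<^sub>R v i =
          (if i = j then (2 * e) *\<^sub>R v j else 0)"
        by (cases "i = j"; cases "j \<in> A") (simp_all add: flip_def e_def)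
    qed
    also have "\<dots> = (2 * e) *\<^sub>R v j" using j by simp
    finally have diff: "sign_sum v N A - sign_sum v N (flip A) = (2 * e) *\<^sub>R v j" .
    have "\<bar>e\<bar> = 1" by (simp add: e_def)
    then have "norm (v j) = norm ((1/2) *\<^sub>R (sign_sum v N A - sign_sum v N (flip A)))"
      unfolding diff by simp
    then have "norm (v j) powr p \<le> (F A + F (flip A)) / 2"
      using norm_powr_midpoint[OF p, of "sign_sum v N A" "sign_sum v N (flip A)"]
      by (simp only: F_def)
    then show ?thesis by simp
  qed
  have "(\<Sum>A\<in>Pow {..<N}. F (flip A)) = (\<Sum>A\<in>Pow {..<N}. F A)"
    by (rule sum.reindex_bij_betw[OF flip])
  moreover have "(\<Sum>A\<in>Pow {..<N}. 2 * norm (v j) powr p) \<le> (\<Sum>A\<in>Pow {..<N}. F A + F (flip A))"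
    by (intro sum_mono pair)
  ultimately show ?thesis by (simp add: sum.distrib card_Pow F_def)
qed

lemma subspace_dual:
  fixes smul :: "'k::real_normed_field \<Rightarrow> 'a::real_normed_vector \<Rightarrow> 'a"
  shows "subspace (dual smul)"
proof (rule subspaceI)
  have bounded: "\<exists>B. \<forall>x. norm (blinfun_apply f x) \<le> B * norm x" for f :: "'a \<Rightarrow>\<^sub>L 'k"
    using norm_blinfun[of f] by blast
  show "0 \<in> dual smul"
    using bounded by (auto simp: dual_def functionals_on_def)
  fix f g :: "'a \<Rightarrow>\<^sub>L 'k" and c :: real
  assume f: "f \<in> dual smul"
  show "c *\<^sub>R f \<in> dual smul"
    using f bounded[of "c *\<^sub>R f"]
    by (auto simp: dual_def functionals_on_def blinfun.bilinear_simps algebra_simps)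
  assume "g \<in> dual smul"
  then show "f + g \<in> dual smul"
    using f bounded[of "f + g"]
    by (auto simp: dual_def functionals_on_def blinfun.bilinear_simps algebra_simps)
qed

lemma closed_dual:
  fixes smul :: "'k::real_normed_field \<Rightarrow> 'a::real_normed_vector \<Rightarrow> 'a"
  shows "closed (dual smul)"
proof -
  have "dual smul = (\<Inter>c x. {f. blinfun_apply f (smul c x) = c * blinfun_apply f x})"
    using norm_blinfun by (auto simp: dual_def functionals_on_def blinfun.bilinear_simps)
  also have "closed \<dots>"
    by (intro closed_INT ballI closed_Collect_eq continuous_intros)
  finally show ?thesis .
qed

lemma evaluation_functional:
  fixes smul :: "'k::real_normed_field \<Rightarrow> 'a::real_normed_vector \<Rightarrow> 'a"
  shows "(\<lambda>f. blinfun_apply f x) \<in> functionals_on dual_scale (dual smul)"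
proof -
  have "norm (blinfun_apply f x) \<le> norm x * norm f" for f :: "'a \<Rightarrow>\<^sub>L 'k"
    using norm_blinfun[of f x] by (simp add: mult.commute)
  then show ?thesis by (auto simp: functionals_on_def blinfun.bilinear_simps)
qed

text \<open>
  For a choice of signs let \<open>g = \<Sum>i<N. \<plusminus> f i\<close>. Hoelder's inequality and the hypothesis on \<open>f\<close> give
  \<open>norm g powr p \<le> C * N powr (p - 1)\<close>, so by the hypothesis on \<open>y\<close> the sum of the \<open>p\<close>-th powers of
  \<open>g (y j)\<close> is at most \<open>C * C' * N powr (p - 1)\<close>. On average over the signs the powers of \<open>g (y j)\<close> dominate
  those of the diagonal term \<open>f j (y j)\<close>. The signs are put on the functionals rather than on the vectors
  because the norm of \<open>g\<close> can be estimated directly from its values.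
\<close>

lemma diagonal_p_sum_bound:
  fixes f :: "nat \<Rightarrow> 'a::real_normed_vector \<Rightarrow>\<^sub>L 'k::real_normed_vector" and y :: "nat \<Rightarrow> 'a"
  assumes p: "1 \<le> p" and D: "subspace D" "\<And>n. f n \<in> D" and C: "0 \<le> C" "0 \<le> C'"
    and f: "\<And>N x. (\<Sum>i<N. norm (blinfun_apply (f i) x) powr p) \<le> C * norm x powr p"
    and y: "\<And>N g. g \<in> D \<Longrightarrow> (\<Sum>j<N. norm (blinfun_apply g (y j)) powr p) \<le> C' * norm g powr p"
  shows "(\<Sum>j<N. norm (blinfun_apply (f j) (y j)) powr p) \<le> C * C' * real N powr (p - 1)"
proof -
  have norm_g: "norm (sign_sum f N A) powr p \<le> real N powr (p - 1) * C" for A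
  proof -
    define B where "B = (real N powr (p - 1) * C) powr (1 / p)"
    have "norm (blinfun_apply (sign_sum f N A) x) \<le> B * norm x" for x
    proof -
      have "norm (blinfun_apply (sign_sum f N A) x) \<le> (\<Sum>i<N. norm (blinfun_apply (f i) x))"
        by (auto simp: sign_sum_def blinfun.bilinear_simps intro!: sum_norm_le)
      then have "norm (blinfun_apply (sign_sum f N A) x) powr p \<le>
          (\<Sum>i<N. norm (blinfun_apply (f i) x)) powr p"
        using p by (intro powr_mono2) auto
      also have "\<dots> \<le> real N powr (p - 1) * (\<Sum>i<N. norm (blinfun_apply (f i) x) powr p)"
        by (intro powr_sum_le p) auto
      also have "\<dots> \<le> real N powr (p - 1) * (C * norm x powr p)"
        by (intro mult_left_mono f) auto
      finally have "(norm (blinfun_apply (sign_sum f N A) x) powr p) powr (1 / p) \<le>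
          (real N powr (p - 1) * C * norm x powr p) powr (1 / p)"
        using p by (intro powr_mono2) (auto simp: mult.assoc)
      then show ?thesis using p C by (simp add: B_def powr_powr powr_mult)
    qed
    then have "norm (sign_sum f N A) \<le> B"
      by (intro norm_blinfun_bound) (simp_all add: B_def)
    then have "norm (sign_sum f N A) powr p \<le> B powr p" using p by (intro powr_mono2) auto
    then show ?thesis using p C by (simp add: B_def powr_powr)
  qed
  have "2 ^ N * (\<Sum>j<N. norm (blinfun_apply (f j) (y j)) powr p) \<le>
      (\<Sum>j<N. \<Sum>A\<in>Pow {..<N}. norm (blinfun_apply (sign_sum f N A) (y j)) powr p)"
    unfolding sum_distrib_left
  proof (rule sum_mono)
    fix j assume "j \<in> {..<N}"
    then have "2 ^ N * norm (blinfun_apply (f j) (y j)) powr p \<le>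
        (\<Sum>A\<in>Pow {..<N}. norm (sign_sum (\<lambda>i. blinfun_apply (f i) (y j)) N A) powr p)"
      using norm_powr_le_average_sign_sum[OF p, of j N "\<lambda>i. blinfun_apply (f i) (y j)"] by simp
    then show "2 ^ N * norm (blinfun_apply (f j) (y j)) powr p \<le>
        (\<Sum>A\<in>Pow {..<N}. norm (blinfun_apply (sign_sum f N A) (y j)) powr p)"
      by (simp add: sign_sum_def blinfun.bilinear_simps)
  qed
  also have "\<dots> = (\<Sum>A\<in>Pow {..<N}. \<Sum>j<N. norm (blinfun_apply (sign_sum f N A) (y j)) powr p)"
    by (rule sum.swap)
  also have "\<dots> \<le> (\<Sum>A\<in>Pow {..<N}. C' * (real N powr (p - 1) * C))"
  proof (rule sum_mono)
    fix A
    have "sign_sum f N A \<in> D"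
      unfolding sign_sum_def using D by (intro subspace_sum subspace_scale) auto
    then have "(\<Sum>j<N. norm (blinfun_apply (sign_sum f N A) (y j)) powr p) \<le>
        C' * norm (sign_sum f N A) powr p" by (rule y)
    also have "\<dots> \<le> C' * (real N powr (p - 1) * C)" by (intro mult_left_mono norm_g C)
    finally show "(\<Sum>j<N. norm (blinfun_apply (sign_sum f N A) (y j)) powr p) \<le>
        C' * (real N powr (p - 1) * C)" .
  qed
  also have "\<dots> = 2 ^ N * (C * C' * real N powr (p - 1))" by (simp add: card_Pow algebra_simps)
  finally show ?thesis by simp
qed

text \<open>
  Real and complex spaces are treated together through the one consequence of the Hahn-Banach theorem that
  is used. The constant 2 replaces the optimal 1 because it comes for free in the complex case.
\<close>

locale norming_scaling = normed_scaling smul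
  for smul :: "'k::{real_normed_field,banach} \<Rightarrow> 'a::banach \<Rightarrow> 'a" +
  assumes norming: "\<exists>\<phi>\<in>functionals_on smul UNIV.
      (\<forall>x. norm (\<phi> x) \<le> 2 * norm x) \<and> norm a \<le> norm (\<phi> a)"
begin

lemma bounded_linear_functional:
  assumes "\<phi> \<in> functionals_on smul UNIV"
  shows "bounded_linear \<phi>"
proof -
  obtain B where "\<And>x. norm (\<phi> x) \<le> B * norm x" using assms by (auto simp: functionals_on_def)
  moreover have "\<phi> (r *\<^sub>R x) = r *\<^sub>R \<phi> x" for r x
    using assms by (simp add: functionals_on_def scaleR_conv_of_real flip: smul_of_real)
  ultimately show ?thesis
    using assms by (intro bounded_linear_intro[where K = B]) (auto simp: functionals_on_def mult.commute)
qed

lemma functional_as_dual_element: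
  assumes "\<phi> \<in> functionals_on smul UNIV"
  obtains f where "f \<in> dual smul" "blinfun_apply f = \<phi>"
proof
  show "blinfun_apply (Blinfun \<phi>) = \<phi>"
    by (intro bounded_linear_Blinfun_apply bounded_linear_functional assms)
  then show "Blinfun \<phi> \<in> dual smul" using assms by (simp add: dual_def)
qed

text \<open>
  This is where \<open>p < 2\<close> enters. If all \<open>f n (y n)\<close> were at least \<open>e\<close> in norm, the diagonal sum would be at least
  \<open>N * e powr p\<close>, which the bound by a multiple of \<open>N powr (p - 1)\<close> forbids for large \<open>N\<close>. It is the part
  needed here of Pitt's theorem that, for \<open>1 < p\<close>, operators from \<open>\<ell>\<^sup>q\<close> to \<open>\<ell>\<^sup>p\<close>, with
  \<open>1/p + 1/q = 1\<close> and so \<open>p < q\<close>, are compact.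
\<close>

lemma weakly_p_summable_pairing_small:
  assumes p: "1 \<le> p" "p < 2"
    and f: "weakly_p_summable p dual_scale (dual smul) f"
    and y: "weakly_p_summable p smul UNIV y"
    and e: "0 < e"
  shows "\<exists>n. norm (blinfun_apply (f n) (y n)) < e"
proof (rule ccontr)
  assume "\<not> ?thesis"
  then have large: "e \<le> norm (blinfun_apply (f n) (y n))" for n by (meson not_less)
  have fD: "f n \<in> dual smul" for n using f by (simp add: weakly_p_summable_def)
  have "summable (\<lambda>n. norm (blinfun_apply (f n) x) powr p)" for x
    using f evaluation_functional[of x smul] by (auto simp: weakly_p_summable_def)
  then obtain C where C: "0 \<le> C"
      "\<And>N x. (\<Sum>i<N. norm (blinfun_apply (f i) x) powr p) \<le> C * norm x powr p"
    using uniform_p_summability[where g = "\<lambda>n. blinfun_apply (f n)", OF p(1) closed_UNIV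
        Real_Vector_Spaces.subspace_UNIV blinfun.bounded_linear_right] by auto
  have "summable (\<lambda>n. norm (blinfun_apply g (y n)) powr p)" if "g \<in> dual smul" for g
    using y that by (auto simp: weakly_p_summable_def dual_def)
  then obtain C' where C': "0 \<le> C'" "\<And>N g. g \<in> dual smul \<Longrightarrow>
      (\<Sum>j<N. norm (blinfun_apply g (y j)) powr p) \<le> C' * norm g powr p"
    using uniform_p_summability[where g = "\<lambda>n g. blinfun_apply g (y n)", OF p(1)
        closed_dual[of smul] subspace_dual[of smul] blinfun.bounded_linear_left] by auto
  have upper: "real N powr (2 - p) \<le> C * C' / e powr p" if N: "0 < N" for N
  proof -
    have "real N * e powr p \<le> (\<Sum>j<N. norm (blinfun_apply (f j) (y j)) powr p)"
      using sum_mono[of "{..<N}" "\<lambda>_. e powr p" "\<lambda>j. norm (blinfun_apply (f j) (y j)) powr p"]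
        large e p by (simp add: powr_mono2)
    also have "\<dots> \<le> C * C' * real N powr (p - 1)"
      by (rule diagonal_p_sum_bound[OF p(1) subspace_dual fD C(1) C'(1) C(2) C'(2)])
    finally have "real N powr 1 * e powr p \<le> C * C' * real N powr (p - 1)" using N by simp
    moreover have "real N powr 1 = real N powr (2 - p) * real N powr (p - 1)"
      by (simp flip: powr_add)
    ultimately have "real N powr (2 - p) * e powr p * real N powr (p - 1) \<le>
        C * C' * real N powr (p - 1)"
      by (simp add: mult.assoc mult.left_commute mult.commute)
    then have "real N powr (2 - p) * e powr p \<le> C * C'" using N by simp
    then show ?thesis using e by (simp add: field_simps)
  qed
  define B where "B = C * C' / e powr p"
  have B: "0 \<le> B" using C(1) C'(1) by (simp add: B_def)
  obtain N where N: "B powr (1 / (2 - p)) < real N" using reals_Archimedean2 by blast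
  moreover have "0 \<le> B powr (1 / (2 - p))" by simp
  ultimately have "0 < N" by linarith
  have "(B powr (1 / (2 - p))) powr (2 - p) < real N powr (2 - p)"
    using N p by (intro powr_less_mono2) auto
  then have "B < real N powr (2 - p)" using p B by (simp add: powr_powr)
  then show False using upper[OF \<open>0 < N\<close>] by (simp add: B_def)
qed

section \<open>Weakly p-Cauchy sequences\<close>

lemma weakly_p_Cauchy_functional:
  assumes p: "0 < p" and x: "weakly_p_Cauchy p smul x" and \<phi>: "\<phi> \<in> functionals_on smul UNIV"
  shows "strict_mono k \<Longrightarrow> strict_mono j \<Longrightarrow> summable (\<lambda>n. norm (\<phi> (x (k n)) - \<phi> (x (j n))) powr p)"
    and "Cauchy (\<lambda>n. \<phi> (x n))"
proof -
  interpret bounded_linear \<phi> by (rule bounded_linear_functional[OF \<phi>])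
  show sm: "summable (\<lambda>n. norm (\<phi> (x (k n)) - \<phi> (x (j n))) powr p)"
    if "strict_mono k" "strict_mono j" for k j
    using x \<phi> that by (simp add: weakly_p_Cauchy_def weakly_p_summable_def flip: diff)
  show "Cauchy (\<lambda>n. \<phi> (x n))" using p by (rule Cauchy_if_differences_p_summable) (rule sm)
qed

text \<open>
  Uniform boundedness on the dual space, transferred back to \<open>x\<close> by norming functionals.
\<close>

lemma weakly_bounded_imp_bounded:
  fixes x :: "nat \<Rightarrow> 'a"
  assumes "\<And>\<phi>. \<phi> \<in> functionals_on smul UNIV \<Longrightarrow> bounded (range (\<lambda>n. \<phi> (x n)))"
  shows "bounded (range x)"
proof -
  define h where "h n f = norm (blinfun_apply f (x n))" for n and f :: "'a \<Rightarrow>\<^sub>L 'k"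
  have cont: "continuous_on UNIV (h n)" for n
    unfolding h_def by (intro continuous_intros)
  have mid: "h n ((1/2) *\<^sub>R (f - g)) \<le> max (h n f) (h n g)" for n f g
    using norm_powr_midpoint[of 1 "blinfun_apply f (x n)" "blinfun_apply g (x n)"]
    by (simp add: h_def blinfun.bilinear_simps max_def split: if_splits)
  have bdd: "\<exists>M. \<forall>n. h n f \<le> M" if "f \<in> dual smul" for f
    using assms[of "blinfun_apply f"] that by (auto simp: h_def dual_def bounded_iff)
  obtain r M where r: "0 < r" and M: "\<And>n f. f \<in> dual smul \<Longrightarrow> norm f \<le> r \<Longrightarrow> h n f \<le> M"
    using uniform_boundedness_on_closed_subspace[where h = h, OF closed_dual[of smul] subspace_dual[of smul] cont mid bdd] by blast
  have "norm (x n) \<le> 2 * M / r" for n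
  proof -
    obtain \<phi> where \<phi>: "\<phi> \<in> functionals_on smul UNIV" "\<And>z. norm (\<phi> z) \<le> 2 * norm z"
        "norm (x n) \<le> norm (\<phi> (x n))"
      using norming by blast
    obtain f where f: "f \<in> dual smul" "blinfun_apply f = \<phi>"
      using functional_as_dual_element[OF \<phi>(1)] .
    have "norm f \<le> 2" using \<phi>(2) f(2) by (intro norm_blinfun_bound) auto
    then have "h n ((r / 2) *\<^sub>R f) \<le> M"
      using r f(1) by (intro M Real_Vector_Spaces.subspace_scale[OF subspace_dual]) auto
    then have "r / 2 * norm (\<phi> (x n)) \<le> M"
      using r f(2) by (simp add: h_def blinfun.bilinear_simps)
    moreover have "r / 2 * norm (x n) \<le> r / 2 * norm (\<phi> (x n))"
      using r \<phi>(3) by (intro mult_left_mono) auto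
    ultimately have "r / 2 * norm (x n) \<le> M" by linarith
    then show ?thesis using r by (simp add: field_simps)
  qed
  then show ?thesis by (auto simp: bounded_iff)
qed

text \<open>
  A gliding hump. Otherwise \<open>f n (x m) > e / 2\<close> in norm for pairs \<open>(n, m)\<close> with \<open>n\<close> arbitrarily large; as
  \<open>f n z\<close> tends to 0 for each fixed \<open>z\<close>, the index \<open>m\<close> grows too, and each \<open>n\<close> can be chosen so large that
  the functional is below \<open>e / 4\<close> at the vector chosen before. The differences \<open>y\<close> of consecutive vectors
  are weakly \<open>p\<close>-summable, because \<open>x\<close> is weakly \<open>p\<close>-Cauchy, and they pair with the functionals to
  values above \<open>e / 4\<close>, contrary to the previous section.
\<close>

lemma range_weakly_p_Cauchy_is_p_V_star_set:
  assumes p: "1 \<le> p" "p < 2" and x: "weakly_p_Cauchy p smul x"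
  shows "p_V_star_set p smul (range x)"
  unfolding p_V_star_set_def
proof (intro conjI allI impI)
  show bx: "bounded (range x)"
    using p weakly_p_Cauchy_functional(2)[OF _ x] 
    by (intro weakly_bounded_imp_bounded cauchy_imp_bounded) auto
  fix f assume f: "weakly_p_summable p dual_scale (dual smul) f"
  have pointwise: "(\<lambda>n. blinfun_apply (f n) z) \<longlonglongrightarrow> 0" for z
  proof -
    have "summable (\<lambda>n. norm (blinfun_apply (f n) z) powr p)"
      using f evaluation_functional[of z smul] by (auto simp: weakly_p_summable_def)
    then have "(\<lambda>n. (norm (blinfun_apply (f n) z) powr p) powr (1 / p)) \<longlonglongrightarrow> 0 powr (1 / p)"
      using p by (intro tendsto_powr' summable_LIMSEQ_zero) auto
    then show ?thesis using p by (simp add: powr_powr tendsto_norm_zero_iff)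
  qed
  have bdd: "bdd_above ((\<lambda>z. norm (blinfun_apply (f n) z)) ` range x)" for n
  proof -
    have "bounded (blinfun_apply (f n) ` range x)"
      by (rule bounded_linear_image[OF bx blinfun.bounded_linear_right])
    then show ?thesis by (auto simp: bounded_iff bdd_above_def)
  qed
  show "(\<lambda>n. SUP z\<in>range x. norm (blinfun_apply (f n) z)) \<longlonglongrightarrow> 0"
  proof (rule ccontr)
    assume "\<not> ?thesis"
    then obtain e where e: "0 < e"
      and "\<And>n0. \<exists>n\<ge>n0. e \<le> norm (SUP z\<in>range x. norm (blinfun_apply (f n) z))"
      by (auto simp: LIMSEQ_def dist_norm not_less)
    moreover have "norm (SUP z\<in>range x. norm (blinfun_apply (f n) z)) \<le> e / 2"
      if "\<And>m. norm (blinfun_apply (f n) (x m)) \<le> e / 2" for n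
    proof -
      have "(SUP z\<in>range x. norm (blinfun_apply (f n) z)) \<le> e / 2"
        using that by (intro cSUP_least) auto
      moreover have "0 \<le> (SUP z\<in>range x. norm (blinfun_apply (f n) z))"
        by (rule cSUP_upper2[OF bdd, of "x 0"]) auto
      ultimately show ?thesis by simp
    qed
    ultimately have large: "\<exists>n\<ge>n0. \<exists>m. e / 2 < norm (blinfun_apply (f n) (x m))" for n0
      using e by (smt (verit, best) field_sum_of_halves not_less)
    have step: "\<exists>n' m'. e / 2 < norm (blinfun_apply (f n') (x m')) \<and> n < n' \<and> m < m' \<and>
        norm (blinfun_apply (f n') (x m)) < e / 4" for n m
    proof -
      have "\<forall>\<^sub>F n in sequentially. norm (blinfun_apply (f n) (x i)) < e / 4" for i
        using pointwise[of "x i"] e by (intro order_tendstoD(2)[of _ 0]) (auto intro: tendsto_norm_zero)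
      then have "\<forall>\<^sub>F n in sequentially. \<forall>i\<in>{..m}. norm (blinfun_apply (f n) (x i)) < e / 4"
        by (simp add: eventually_ball_finite)
      then obtain n0 where n0: "\<And>n i. n0 \<le> n \<Longrightarrow> i \<le> m \<Longrightarrow> norm (blinfun_apply (f n) (x i)) < e / 4"
        unfolding eventually_sequentially by auto
      obtain n' m' where n': "max n0 (Suc n) \<le> n'" "e / 2 < norm (blinfun_apply (f n') (x m'))"
        using large by blast
      \<comment> \<open>All vectors up to index \<open>m\<close> have been made small at once, so the large value lies beyond them.\<close>
      have "m < m'" using n0[of n' m'] n' e by (cases "m' \<le> m") auto
      then show ?thesis using n' n0[of n' m] by (intro exI[of _ n'] exI[of _ m']) auto
    qed
    obtain n0 m0 where "e / 2 < norm (blinfun_apply (f n0) (x m0))" using large by blast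
    then have "\<exists>s. \<forall>i. e / 2 < norm (blinfun_apply (f (fst (s i))) (x (snd (s i)))) \<and>
        (fst (s i) < fst (s (Suc i)) \<and> snd (s i) < snd (s (Suc i)) \<and>
         norm (blinfun_apply (f (fst (s (Suc i)))) (x (snd (s i)))) < e / 4)"
      using step
      by (intro dependent_nat_choice[where
            P = "\<lambda>_ u. e / 2 < norm (blinfun_apply (f (fst u)) (x (snd u)))"]) auto
    then obtain s where s: "\<And>i. e / 2 < norm (blinfun_apply (f (fst (s i))) (x (snd (s i))))"
      and s_mono: "\<And>i. fst (s i) < fst (s (Suc i))" "\<And>i. snd (s i) < snd (s (Suc i))"
      and s_small: "\<And>i. norm (blinfun_apply (f (fst (s (Suc i)))) (x (snd (s i)))) < e / 4"
      by blast
    define g where "g i = f (fst (s (Suc i)))" for i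
    define y where "y i = x (snd (s (Suc i))) - x (snd (s i))" for i
    have "weakly_p_summable p dual_scale (dual smul) g"
      unfolding g_def using s_mono
      by (intro weakly_p_summable_subsequence[OF f]) (simp add: strict_mono_Suc_iff)
    moreover have "weakly_p_summable p smul UNIV y"
    proof -
      have "strict_mono (\<lambda>i. snd (s i))" "strict_mono (\<lambda>i. snd (s (Suc i)))"
        using s_mono by (simp_all add: strict_mono_Suc_iff)
      then show ?thesis using x by (simp add: weakly_p_Cauchy_def y_def[abs_def])
    qed
    ultimately obtain i where "norm (blinfun_apply (g i) (y i)) < e / 4"
      using weakly_p_summable_pairing_small[OF p, of g y "e / 4"] e by auto
    moreover have "norm (blinfun_apply (f (fst (s (Suc i)))) (x (snd (s (Suc i))))) \<le>
        norm (blinfun_apply (g i) (y i)) + norm (blinfun_apply (f (fst (s (Suc i)))) (x (snd (s i))))"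
      using norm_triangle_sub[of "blinfun_apply (f (fst (s (Suc i)))) (x (snd (s (Suc i))))"
          "blinfun_apply (f (fst (s (Suc i)))) (x (snd (s i)))"]
      by (simp add: g_def y_def blinfun.bilinear_simps)
    ultimately show False using s[of "Suc i"] s_small[of i] by linarith
  qed
qed

text \<open>
  A point common to the weak closures of all tails of \<open>x\<close>: it exists by the finite intersection
  property, and any functional along which \<open>x\<close> converges takes the limit as its value there.
\<close>

lemma weak_cluster_point:
  assumes "relatively_weakly_compact smul (range x)"
  obtains l where "\<And>\<phi> a. \<phi> \<in> functionals_on smul UNIV \<Longrightarrow> (\<lambda>n. \<phi> (x n)) \<longlonglongrightarrow> a \<Longrightarrow> \<phi> l = a"
proof -
  define T where "T = weak_topology smul"
  have "(\<lambda>_. 0) \<in> functionals_on smul UNIV"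
    by (auto simp: functionals_on_def intro!: exI[of _ 0])
  then have top: "topspace T = UNIV"
    unfolding T_def weak_topology_def by (auto simp: vimage_def) 
  have cont: "continuous_map T euclidean \<phi>" if \<phi>: "\<phi> \<in> functionals_on smul UNIV" for \<phi>
    unfolding continuous_map_def
  proof (intro conjI allI impI)
    fix U :: "'k set" assume "openin euclidean U"
    then have "openin T (\<phi> -` U)"
      unfolding T_def weak_topology_def using \<phi> by (intro topology_generated_by_Basis) auto
    then show "openin T {z \<in> topspace T. \<phi> z \<in> U}" by (simp add: top vimage_def)
  qed simp
  define tail where "tail n = T closure_of (x ` {n..})" for n
  have "T closure_of range x \<inter> \<Inter>(range tail) \<noteq> {}"
  proof -
    have "T closure_of range x \<inter> \<Inter>\<F> \<noteq> {}" if F: "finite \<F>" "\<F> \<subseteq> range tail" for \<F>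
    proof -
      obtain I where I: "finite I" "\<F> = tail ` I" using F by (meson finite_subset_image)
      obtain m where "\<And>i. i \<in> I \<Longrightarrow> i \<le> m" using I(1) by (meson finite_nat_set_iff_bounded_le)
      then have "x m \<in> x ` {i..}" if "i \<in> I" for i using that by auto
      moreover have "S \<subseteq> T closure_of S" for S by (simp add: closure_of_subset top)
      ultimately have "x m \<in> T closure_of range x \<inter> \<Inter>\<F>" unfolding I(2) tail_def by blast
      then show ?thesis by blast
    qed
    moreover have "compactin T (T closure_of range x)"
      using assms by (simp add: relatively_weakly_compact_def T_def)
    moreover have "\<forall>C\<in>range tail. closedin T C" by (auto simp: tail_def)
    ultimately show ?thesis
      using compactin_fip[THEN iffD1, THEN conjunct2, rule_format, of T _ "range tail"] by metis
  qed
  then obtain l where l: "\<And>n. l \<in> tail n" by blast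
  show thesis
  proof
    fix \<phi> a assume \<phi>: "\<phi> \<in> functionals_on smul UNIV" and lim: "(\<lambda>n. \<phi> (x n)) \<longlonglongrightarrow> a"
    show "\<phi> l = a"
    proof (rule ccontr)
      assume "\<phi> l \<noteq> a"
      then obtain U V where UV: "open U" "open V" "\<phi> l \<in> U" "a \<in> V" "U \<inter> V = {}"
        using hausdorff[OF \<open>\<phi> l \<noteq> a\<close>] by metis
      obtain n where n: "\<And>m. n \<le> m \<Longrightarrow> \<phi> (x m) \<in> V"
        using topological_tendstoD[OF lim UV(2,4)] by (auto simp: eventually_sequentially)
      have "\<phi> l \<in> closure (\<phi> ` x ` {n..})"
        using continuous_map_image_closure_subset[OF cont[OF \<phi>], of "x ` {n..}"] l[of n]
        by (auto simp: tail_def)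
      then have "U \<inter> \<phi> ` x ` {n..} \<noteq> {}"
        using UV(1,3) open_Int_closure_eq_empty[of U] by blast
      then show False using n UV(5) by auto
    qed
  qed
qed

lemma property_p_V_star_imp_weakly_seq_complete:
  assumes p: "1 \<le> p" "p < 2" and V: "property_p_V_star p smul"
  shows "weakly_seq_complete_of_order p smul"
  unfolding weakly_seq_complete_of_order_def
proof (intro allI impI)
  fix x assume x: "weakly_p_Cauchy p smul x"
  then have "relatively_weakly_compact smul (range x)"
    using V range_weakly_p_Cauchy_is_p_V_star_set[OF p] by (simp add: property_p_V_star_def)
  then obtain l where l: "\<And>\<phi> a. \<phi> \<in> functionals_on smul UNIV \<Longrightarrow> (\<lambda>n. \<phi> (x n)) \<longlonglongrightarrow> a \<Longrightarrow> \<phi> l = a"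
    using weak_cluster_point by blast
  have "summable (\<lambda>n. norm (\<phi> (x n - l)) powr p)" if \<phi>: "\<phi> \<in> functionals_on smul UNIV" for \<phi>
  proof -
    interpret bounded_linear \<phi> by (rule bounded_linear_functional[OF \<phi>])
    note C = weakly_p_Cauchy_functional[OF _ x \<phi>]
    have "convergent (\<lambda>n. \<phi> (x n))" using C(2) p by (simp add: Cauchy_convergent_iff)
    then have "(\<lambda>n. \<phi> (x n)) \<longlonglongrightarrow> \<phi> l" using l[OF \<phi>] by (auto simp: convergent_def)
    then have "summable (\<lambda>n. norm (\<phi> (x n) - \<phi> l) powr p)"
      using C(1)[of "\<lambda>n. n"] p by (intro p_summable_distance_to_limit) (auto simp: strict_mono_def)
    then show ?thesis by (simp add: diff)
  qed
  then show "weakly_p_convergent p smul x"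
    by (auto simp: weakly_p_convergent_def weakly_p_convergent_to_def weakly_p_summable_def)
qed

end

section \<open>Real and complex Banach spaces\<close>

lemma norming_scaling_real: "norming_scaling (scaleR :: real \<Rightarrow> 'a::banach \<Rightarrow> 'a)"
proof (rule norming_scaling.intro[OF normed_scaling_scaleR], unfold_locales)
  fix a :: 'a
  obtain f where f: "linear f" "\<And>x. \<bar>f x\<bar> \<le> norm x" "f a = norm a"
    using norming_real_functional by blast
  have "f \<in> functionals_on scaleR UNIV"
    using f(2) by (auto simp: functionals_on_def linear_add[OF f(1)] linear_scale[OF f(1)]
        intro!: exI[of _ 1])
  moreover have "\<bar>f x\<bar> \<le> 2 * norm x" for x using f(2)[of x] norm_ge_zero[of x] by linarith
  ultimately show "\<exists>\<phi>\<in>functionals_on scaleR UNIV. (\<forall>x. norm (\<phi> x) \<le> 2 * norm x) \<and> norm a \<le> norm (\<phi> a)"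
    using f(3) by (intro bexI[of _ f]) auto
qed

text \<open>
  The complex-linear functional with real part \<open>f\<close> is \<open>x \<mapsto> f x - \<i> f (\<i> x)\<close>. The triangle inequality
  bounds it by twice the norm.
\<close>

lemma norming_scaling_complex:
  fixes smul :: "complex \<Rightarrow> 'a::banach \<Rightarrow> 'a"
  assumes "normed_scaling smul"
  shows "norming_scaling smul"
proof (rule norming_scaling.intro[OF assms], unfold_locales)
  interpret normed_scaling smul by (rule assms)
  fix a :: 'a
  obtain f where f: "linear f" "\<And>x. \<bar>f x\<bar> \<le> norm x" "f a = norm a"
    using norming_real_functional by blast
  define \<phi> where "\<phi> x = Complex (f x) (- f (smul \<i> x))" for x
  have bound: "norm (\<phi> x) \<le> 2 * norm x" for x
  proof -
    have "norm (\<phi> x) \<le> \<bar>f x\<bar> + \<bar>f (smul \<i> x)\<bar>"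
      using cmod_le[of "\<phi> x"] by (simp add: \<phi>_def)
    also have "\<dots> \<le> norm x + norm (smul \<i> x)" by (intro add_mono f(2))
    finally show ?thesis by (simp add: norm_smul)
  qed
  have split: "smul c x = Re c *\<^sub>R x + Im c *\<^sub>R smul \<i> x" for c x
  proof -
    have "c = of_real (Re c) + of_real (Im c) * \<i>" by (simp add: complex_eq_iff)
    then have "smul c x = smul (of_real (Re c) + of_real (Im c) * \<i>) x" by (rule arg_cong)
    also have "\<dots> = smul (of_real (Re c)) x + smul (of_real (Im c)) (smul \<i> x)"
      by (simp add: scale_left_distrib)
    finally show ?thesis by (simp only: smul_of_real)
  qed
  have "\<phi> (smul c x) = c * \<phi> x" for c x
  proof -
    have "smul \<i> (smul c x) = Re c *\<^sub>R smul \<i> x - Im c *\<^sub>R x"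
      using split[of "\<i> * c" x] by simp
    then have "f (smul \<i> (smul c x)) = Re c * f (smul \<i> x) - Im c * f x"
      by (simp only: linear_diff[OF f(1)] linear_scale[OF f(1)] real_scaleR_def)
    moreover have "f (smul c x) = Re c * f x + Im c * f (smul \<i> x)"
      by (simp only: split[of c x] linear_add[OF f(1)] linear_scale[OF f(1)] real_scaleR_def)
    ultimately show ?thesis by (simp add: \<phi>_def complex_eq_iff algebra_simps)
  qed
  moreover have "\<phi> (x + y) = \<phi> x + \<phi> y" for x y
    by (simp add: \<phi>_def complex_eq_iff scale_right_distrib linear_add[OF f(1)])
  ultimately have "\<phi> \<in> functionals_on smul UNIV"
    using bound by (auto simp: functionals_on_def)
  moreover have "norm a \<le> norm (\<phi> a)"
    using abs_Re_le_cmod[of "\<phi> a"] f(3) by (simp add: \<phi>_def)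
  ultimately show "\<exists>\<phi>\<in>functionals_on smul UNIV. (\<forall>x. norm (\<phi> x) \<le> 2 * norm x) \<and> norm a \<le> norm (\<phi> a)"
    using bound by blast
qed

theorem theorem2p15:
  fixes p :: real
    and scaleC :: "complex \<Rightarrow> 'b::banach \<Rightarrow> 'b"
  assumes "1 < p" and "p < 2"
  shows "(property_p_V_star p (scaleR :: real \<Rightarrow> 'a::banach \<Rightarrow> 'a) \<longrightarrow>
            weakly_seq_complete_of_order p (scaleR :: real \<Rightarrow> 'a \<Rightarrow> 'a)) \<and>
         (normed_scaling scaleC \<and> property_p_V_star p scaleC \<longrightarrow>
            weakly_seq_complete_of_order p scaleC)"
proof (intro conjI impI)
  have p: "1 \<le> p" using assms by simp
  note complete = norming_scaling.property_p_V_star_imp_weakly_seq_complete[OF _ p assms(2)]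
  show "weakly_seq_complete_of_order p (scaleR :: real \<Rightarrow> 'a \<Rightarrow> 'a)"
    if "property_p_V_star p (scaleR :: real \<Rightarrow> 'a \<Rightarrow> 'a)"
    using norming_scaling_real that by (rule complete)
  show "weakly_seq_complete_of_order p scaleC"
    if "normed_scaling scaleC \<and> property_p_V_star p scaleC"
    using that norming_scaling_complex[of scaleC] complete[of scaleC] by blast
qed

end
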